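(* Let $V$ be a finite-dimensional real inner product space, let $V_1,\dots,V_n\subseteq V$ be subspaces with $V=\sum_{i=1}^n V_i$ (the sum not necessarily direct), and let $A:V\to V^*$ be a linear operator. Let $\underline{V}=\prod_{i=1}^n V_i$, let $S:\underline{V}\to V$ be the sum operator $S(v_1,\dots,v_n)=\sum_{i=1}^n v_i$, let $S^*:V^*\to\underline{V}^*$ be its adjoint, and set $\underline{A}=S^*AS:\underline{V}\to\underline{V}^*$. If $A$ is an isomorphism, then $$\ker\underline{A}=\ker S,$$ and, for every $f\in V^*$ and every $u\in V$, writing $\underline{f}=S^*f$, $$Au=f\quad\text{if and only if}\quad S\big(\{\underline{u}\in\underline{V}:\underline{A}\,\underline{u}=\underline{f}\}\big)=\{u\}.$$
   Context: $V^*$ denotes the dual space of $V$, and $\underline{V}^*=\prod_{i=1}^n V_i^*$ the dual of $\underline{V}$. The adjoint $S^*$ is the dual (transpose) map: $S^*f=(f|_{V_1},\dots,f|_{V_n})$, i.e. $\langle S^*f,\underline{v}\rangle=\langle f,S\underline{v}\rangle$ for all $f\in V^*$, $\underline{v}\in\underline{V}$, where $\langle\cdot,\cdot\rangle$ is the duality pairing. *)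

theory Defs
  imports "HOL-Analysis.Analysis"
begin

text \<open>
  The space \<open>V\<close> is the type \<open>'a\<close>; its dual is \<open>'a \<Rightarrow>\<^sub>L real\<close>, since every linear functional on a
  finite-dimensional normed space is bounded. A functional on a subspace \<open>U\<close> is a function
  that is linear on \<open>U\<close> and \<open>undefined\<close> outside, so that equality of functions is equality
  of functionals on \<open>U\<close>. Families are likewise indexed extensionally by \<open>{1..n}\<close>.
\<close>

definition prod_space :: "nat \<Rightarrow> (nat \<Rightarrow> 'a set) \<Rightarrow> (nat \<Rightarrow> 'a) set" where
  "prod_space n V = (\<Pi>\<^sub>E i\<in>{1..n}. V i)"

definition dual_on :: "'a::real_vector set \<Rightarrow> ('a \<Rightarrow> real) set" where
  "dual_on U = {g \<in> extensional U.
     (\<forall>x\<in>U. \<forall>y\<in>U. g (x + y) = g x + g y) \<and> (\<forall>c. \<forall>x\<in>U. g (c *\<^sub>R x) = c * g x)}"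

definition prod_dual :: "nat \<Rightarrow> (nat \<Rightarrow> 'a::real_vector set) \<Rightarrow> (nat \<Rightarrow> 'a \<Rightarrow> real) set" where
  "prod_dual n V = (\<Pi>\<^sub>E i\<in>{1..n}. dual_on (V i))"

definition prod_dual_zero :: "nat \<Rightarrow> (nat \<Rightarrow> 'a set) \<Rightarrow> nat \<Rightarrow> 'a \<Rightarrow> real" where
  "prod_dual_zero n V = (\<lambda>i\<in>{1..n}. \<lambda>x\<in>V i. 0)"

definition prod_pairing :: "nat \<Rightarrow> (nat \<Rightarrow> 'a \<Rightarrow> real) \<Rightarrow> (nat \<Rightarrow> 'a) \<Rightarrow> real" where
  "prod_pairing n g v = (\<Sum>i=1..n. g i (v i))"

definition sum_op :: "nat \<Rightarrow> (nat \<Rightarrow> 'a::real_normed_vector) \<Rightarrow> 'a" where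
  "sum_op n v = (\<Sum>i=1..n. v i)"

definition sum_op_adj ::
    "nat \<Rightarrow> (nat \<Rightarrow> 'a set) \<Rightarrow> ('a::real_normed_vector \<Rightarrow>\<^sub>L real) \<Rightarrow> nat \<Rightarrow> 'a \<Rightarrow> real" where
  "sum_op_adj n V f = (\<lambda>i\<in>{1..n}. restrict (blinfun_apply f) (V i))"

definition lifted_op ::
    "nat \<Rightarrow> (nat \<Rightarrow> 'a set) \<Rightarrow> ('a::real_normed_vector \<Rightarrow> ('a \<Rightarrow>\<^sub>L real)) \<Rightarrow>
     (nat \<Rightarrow> 'a) \<Rightarrow> (nat \<Rightarrow> 'a \<Rightarrow> real)" where
  "lifted_op n V A = sum_op_adj n V \<circ> A \<circ> sum_op n"

lemma sum_op_adj_in_prod_dual: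
  assumes "\<And>i. i \<in> {1..n} \<Longrightarrow> subspace (V i)"
  shows "sum_op_adj n V f \<in> prod_dual n V"
  using assms
  by (auto simp: sum_op_adj_def prod_dual_def dual_on_def subspace_add subspace_scale
      blinfun.add_right blinfun.scaleR_right)

lemma prod_pairing_sum_op_adj:
  assumes "v \<in> prod_space n V"
  shows "prod_pairing n (sum_op_adj n V f) v = blinfun_apply f (sum_op n v)"
  using assms
  by (auto simp: prod_pairing_def sum_op_adj_def sum_op_def prod_space_def blinfun.sum_right
      PiE_iff intro!: sum.cong)

end

theory Submission
  imports Defs
begin

text \<open>
  Since \<open>S\<close> is surjective, \<open>S\<^sup>*\<close> is injective, so the lifted equation for \<open>v\<close> with right-hand
  side \<open>S\<^sup>* f\<close> says exactly \<open>A (S v) = f\<close>. Both claims follow, because the fibres of \<open>S\<close> are nonempty.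
\<close>

lemma sum_op_image:
  assumes "(UNIV :: 'a::real_normed_vector set) = {\<Sum>i=1..n. v i | v. \<forall>i\<in>{1..n}. v i \<in> V i}"
  shows "sum_op n ` prod_space n V = UNIV"
proof -
  have "w \<in> sum_op n ` prod_space n V" for w
  proof -
    obtain v where v: "w = (\<Sum>i=1..n. v i)" "\<forall>i\<in>{1..n}. v i \<in> V i"
      using UNIV_I[of w] unfolding assms by blast
    \<comment> \<open>The decomposition \<open>v\<close> may take any values outside
      \<open>{1..n}\<close>, whereas a member of \<open>prod_space n V\<close> must be
      \<open>undefined\<close> there; truncating leaves the sum unchanged.\<close>
    have "restrict v {1..n} \<in> prod_space n V"
      using v(2) by (auto simp: prod_space_def)
    moreover have "w = sum_op n (restrict v {1..n})"
      using v(1) by (simp add: sum_op_def)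
    ultimately show ?thesis by blast
  qed
  then show ?thesis by blast
qed

text \<open>Pairing \<open>sum_op_adj n V f\<close> with \<open>v\<close> gives the value of
  \<open>f\<close> at \<open>sum_op n v\<close>, and these points exhaust the space.\<close>

lemma inj_sum_op_adj:
  assumes "sum_op n ` prod_space n V = UNIV"
  shows "inj (sum_op_adj n V)"
proof (rule injI)
  fix f g assume eq: "sum_op_adj n V f = sum_op_adj n V g"
  show "f = g"
  proof (rule blinfun_eqI)
    fix w
    obtain v where "v \<in> prod_space n V" "w = sum_op n v"
      using assms by blast
    then show "blinfun_apply f w = blinfun_apply g w"
      using prod_pairing_sum_op_adj[of v n V f] prod_pairing_sum_op_adj[of v n V g] eq by simp
  qed
qed

text \<open>Makes the kernel condition the case \<open>f = 0\<close> of the lifted equation, so one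
  equivalence serves both claims.\<close>

lemma prod_dual_zero_eq_sum_op_adj: "prod_dual_zero n V = sum_op_adj n V 0"
  by (auto simp: prod_dual_zero_def sum_op_adj_def restrict_def fun_eq_iff)

theorem theorem1:
  fixes V :: "nat \<Rightarrow> 'a::real_inner set"
    and n :: nat
    and A :: "'a \<Rightarrow> ('a \<Rightarrow>\<^sub>L real)"
  assumes findim: "\<exists>B :: 'a set. finite B \<and> span B = UNIV"
    and subspaces: "\<And>i. i \<in> {1..n} \<Longrightarrow> subspace (V i)"
    and sum_V: "(UNIV :: 'a set) = {\<Sum>i=1..n. v i | v. \<forall>i\<in>{1..n}. v i \<in> V i}"
    and lin: "linear A"
    and iso: "bij A"
  shows "{v \<in> prod_space n V. lifted_op n V A v = prod_dual_zero n V}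
           = {v \<in> prod_space n V. sum_op n v = 0}
       \<and> (\<forall>(f :: 'a \<Rightarrow>\<^sub>L real) u.
           A u = f \<longleftrightarrow>
           sum_op n ` {v \<in> prod_space n V. lifted_op n V A v = sum_op_adj n V f} = {u})"
proof -
  note surj = sum_op_image[OF sum_V]
  have lifted: "lifted_op n V A v = sum_op_adj n V f \<longleftrightarrow> A (sum_op n v) = f" for v f
    using inj_sum_op_adj[OF surj] by (simp add: lifted_op_def inj_eq)
  have inj: "A w = A w' \<longleftrightarrow> w = w'" for w w'
    using iso by (simp add: bij_is_inj inj_eq)
  have ker: "A w = 0 \<longleftrightarrow> w = 0" for w
    using inj[of w 0] lin by (simp add: linear_0)
  \<comment> \<open>The condition on \<open>v\<close> depends only on \<open>sum_op n v\<close>, so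
    by surjectivity the image is the whole fibre of \<open>A\<close> over \<open>f\<close>.\<close>
  have image: "sum_op n ` {v \<in> prod_space n V. A (sum_op n v) = f} = {w. A w = f}" for f
  proof -
    have "sum_op n ` {v \<in> prod_space n V. A (sum_op n v) = f}
        = {w \<in> sum_op n ` prod_space n V. A w = f}" by auto
    then show ?thesis by (simp add: surj)
  qed
  \<comment> \<open>Left to right is membership of \<open>u\<close>; the converse is injectivity of
    \<open>A\<close>.\<close>
  have "{w. A w = f} = {u} \<longleftrightarrow> A u = f" for f u
    by (auto simp: inj)
  then show ?thesis
    by (simp add: image prod_dual_zero_eq_sum_op_adj lifted ker)
qed

end
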